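(* One has $$\vartheta_{\rm irrepresentable}(S,s)\le \vartheta_{\rm adaptive}(S,s),$$ where $$\vartheta_{\rm irrepresentable}(S,s)=\max_{\|\tau_S\|_\infty\le 1}\|\Sigma_{2,1}(S)\Sigma_{1,1}^{-1}(S)\tau_S\|_\infty$$ (maximum over $\tau_S\in\mathbb{R}^{s}$) and $$\vartheta_{\rm adaptive}(S,s)=\sup\left\{\frac{|(f_{\beta_S},f_{\beta_{S^c}})|}{\|f_{\beta_S}\|^2}:\ \beta\in\mathbb{R}^p,\ \beta_S\ne 0,\ \|\beta_{S^c}\|_1\le\sqrt{s}\,\|\beta_S\|_2\right\}.$$
   Context: $Q$ is a probability measure on a measurable space, $\psi_1,\dots,\psi_p\in L_2(Q)$ are real functions, $(\cdot,\cdot)$ and $\|\cdot\|$ are the inner product and norm of $L_2(Q)$, and $f_\beta:=\sum_{j=1}^p\beta_j\psi_j$ for $\beta\in\mathbb{R}^p$. The Gram matrix is $\Sigma=(\sigma_{j,k})$, $\sigma_{j,k}:=(\psi_j,\psi_k)$. $S\subset\{1,\dots,p\}$ is a nonempty index set, $s:=|S|$. For $\beta\in\mathbb{R}^p$ and an index set $\mathcal{N}$, $\beta_{\mathcal N}$ is the vector with entries $\beta_j 1\{j\in\mathcal N\}$ (sometimes identified with the $|\mathcal N|$-vector $(\beta_j)_{j\in\mathcal N}$). $\Sigma_{1,1}(S):=(\sigma_{j,k})_{j,k\in S}$ and $\Sigma_{2,1}(S):=(\sigma_{j,k})_{j\notin S,k\in S}$. Standing assumption: $\Sigma_{1,1}(S)$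 is non-singular. $\|v\|_q$ are the usual $\ell_q$-norms of vectors. *)

theory Defs
  imports
    "HOL-Probability.Probability"
    "Jordan_Normal_Form.DL_Submatrix"
    "Jordan_Normal_Form.Gauss_Jordan_Elimination"
begin

text \<open>
  Indices run over \<open>{..<p}\<close> instead of \<open>{1..p}\<close>. Vectors and matrices are those of
  \<open>Jordan_Normal_Form\<close>, so that all dimensions are ordinary natural numbers; in particular the
  complement of \<open>S\<close> may be empty.
\<close>

definition square_integrable :: "'a measure \<Rightarrow> ('a \<Rightarrow> real) set" where
  "square_integrable Q = {f \<in> borel_measurable Q. integrable Q (\<lambda>x. (f x)\<^sup>2)}"

definition L2_inner :: "'a measure \<Rightarrow> ('a \<Rightarrow> real) \<Rightarrow> ('a \<Rightarrow> real) \<Rightarrow> real" where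
  "L2_inner Q f g = (LINT x|Q. f x * g x)"

definition L2_norm :: "'a measure \<Rightarrow> ('a \<Rightarrow> real) \<Rightarrow> real" where
  "L2_norm Q f = sqrt (L2_inner Q f f)"

definition l1_norm_vec :: "real vec \<Rightarrow> real" where
  "l1_norm_vec v = (\<Sum>i<dim_vec v. \<bar>v $ i\<bar>)"

definition l2_norm_vec :: "real vec \<Rightarrow> real" where
  "l2_norm_vec v = sqrt (\<Sum>i<dim_vec v. (v $ i)\<^sup>2)"

text \<open>The inserted \<open>0\<close> only matters for the vector of dimension \<open>0\<close>, whose norm is \<open>0\<close>.\<close>

definition linf_norm_vec :: "real vec \<Rightarrow> real" where
  "linf_norm_vec v = Max (insert 0 ((\<lambda>i. \<bar>v $ i\<bar>) ` {..<dim_vec v}))"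

definition restrict_vec :: "nat set \<Rightarrow> real vec \<Rightarrow> real vec" where
  "restrict_vec N \<beta> = vec (dim_vec \<beta>) (\<lambda>j. if j \<in> N then \<beta> $ j else 0)"

definition lin_comb :: "(nat \<Rightarrow> 'a \<Rightarrow> real) \<Rightarrow> real vec \<Rightarrow> 'a \<Rightarrow> real" where
  "lin_comb \<psi> \<beta> = (\<lambda>x. \<Sum>j<dim_vec \<beta>. \<beta> $ j * \<psi> j x)"

definition gram_mat :: "'a measure \<Rightarrow> nat \<Rightarrow> (nat \<Rightarrow> 'a \<Rightarrow> real) \<Rightarrow> real mat" where
  "gram_mat Q p \<psi> = mat p p (\<lambda>(j, k). L2_inner Q (\<psi> j) (\<psi> k))"

text \<open>
  \<open>submatrix\<close> enumerates the selected rows and columns increasingly, so a vector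
  \<open>\<tau>\<^sub>S\<close> is indexed by the positions \<open>0, \<dots>, card S - 1\<close> of the elements of \<open>S\<close>.
\<close>

definition gram11 :: "'a measure \<Rightarrow> nat \<Rightarrow> (nat \<Rightarrow> 'a \<Rightarrow> real) \<Rightarrow> nat set \<Rightarrow> real mat" where
  "gram11 Q p \<psi> S = submatrix (gram_mat Q p \<psi>) S S"

definition gram21 :: "'a measure \<Rightarrow> nat \<Rightarrow> (nat \<Rightarrow> 'a \<Rightarrow> real) \<Rightarrow> nat set \<Rightarrow> real mat" where
  "gram21 Q p \<psi> S = submatrix (gram_mat Q p \<psi>) (- S) S"

text \<open>
  \<open>GREATEST\<close> is the literal maximum, so it is meaningful only because the maximum is attained.
  \<open>mat_inverse\<close> returns \<open>None\<close> only for a singular matrix, which the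
  standing assumption on \<open>\<Sigma>\<^sub>1\<^sub>,\<^sub>1(S)\<close> rules out.
\<close>

definition theta_irrepresentable ::
    "'a measure \<Rightarrow> nat \<Rightarrow> (nat \<Rightarrow> 'a \<Rightarrow> real) \<Rightarrow> nat set \<Rightarrow> real" where
  "theta_irrepresentable Q p \<psi> S =
     (GREATEST m. m \<in> {linf_norm_vec (gram21 Q p \<psi> S *\<^sub>v (the (mat_inverse (gram11 Q p \<psi> S)) *\<^sub>v \<tau>)) | \<tau>.
                        \<tau> \<in> carrier_vec (card S) \<and> linf_norm_vec \<tau> \<le> 1})"

text \<open>The supremum is taken in the extended reals, where it exists unconditionally.\<close>

definition theta_adaptive ::
    "'a measure \<Rightarrow> nat \<Rightarrow> (nat \<Rightarrow> 'a \<Rightarrow> real) \<Rightarrow> nat set \<Rightarrow> ereal" where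
  "theta_adaptive Q p \<psi> S =
     Sup {ereal (\<bar>L2_inner Q (lin_comb \<psi> (restrict_vec S \<beta>)) (lin_comb \<psi> (restrict_vec (- S) \<beta>))\<bar>
                   / (L2_norm Q (lin_comb \<psi> (restrict_vec S \<beta>)))\<^sup>2) | \<beta>.
            \<beta> \<in> carrier_vec p \<and> restrict_vec S \<beta> \<noteq> 0\<^sub>v p \<and>
            l1_norm_vec (restrict_vec (- S) \<beta>)
              \<le> sqrt (real (card S)) * l2_norm_vec (restrict_vec S \<beta>)}"

end

theory Submission
  imports Defs
begin

text \<open>
  For \<open>\<tau>\<close> in the unit cube put \<open>v = \<Sigma>\<^sub>1\<^sub>1\<inverse> \<tau>\<close>, let \<open>j\<close> be an index outside \<open>S\<close> at which
  \<open>\<bar>\<Sigma>\<^sub>2\<^sub>1 v\<bar>\<close> is maximal, and test \<open>\<theta>\<^sub>a\<^sub>d\<^sub>a\<^sub>p\<^sub>t\<^sub>i\<^sub>v\<^sub>e\<close> with \<open>\<beta> = v + t e\<^sub>j\<close>, where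
  \<open>t = \<surd>s \<parallel>v\<parallel>\<^sub>2\<close>. The ratio is \<open>t \<bar>(\<Sigma>\<^sub>2\<^sub>1 v)\<^sub>j\<bar> / (v \<cdot> \<tau>)\<close>, and
  \<open>v \<cdot> \<tau> \<le> \<parallel>v\<parallel>\<^sub>1 \<le> t\<close>. A vanishing denominator \<open>v \<cdot> \<tau> = \<parallel>f\<^sub>v\<parallel>\<^sup>2\<close> is harmless,
  because then \<open>f\<^sub>v = 0\<close> almost everywhere and the numerator is \<open>0\<close> too.
\<close>

no_notation Finite_Cartesian_Product.vec_nth (infixl \<open>$\<close> 90)

subsection \<open>The inner product of \<open>L\<^sub>2(Q)\<close>\<close>

text \<open>Domination by \<open>f\<^sup>2 + g\<^sup>2\<close>. It ensures that the inner products
  below are genuine integrals and not the default value 0 of a non-integrable function.\<close>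

lemma integrable_mult_square_integrable:
  assumes "f \<in> square_integrable Q" "g \<in> square_integrable Q"
  shows "integrable Q (\<lambda>x. f x * g x)"
proof (rule Bochner_Integration.integrable_bound)
  show "integrable Q (\<lambda>x. (f x)\<^sup>2 + (g x)\<^sup>2)"
    using assms by (auto simp: square_integrable_def)
  show "(\<lambda>x. f x * g x) \<in> borel_measurable Q"
    using assms by (auto simp: square_integrable_def)
  have "\<bar>a * b\<bar> \<le> a\<^sup>2 + b\<^sup>2" for a b :: real
  proof -
    have "2 * (\<bar>a\<bar> * \<bar>b\<bar>) \<le> a\<^sup>2 + b\<^sup>2"
      using sum_squares_bound[of "\<bar>a\<bar>" "\<bar>b\<bar>"] by simp
    moreover have "0 \<le> \<bar>a\<bar> * \<bar>b\<bar>" by simp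
    ultimately show ?thesis unfolding abs_mult by linarith
  qed
  then show "AE x in Q. norm (f x * g x) \<le> norm ((f x)\<^sup>2 + (g x)\<^sup>2)"
    by simp
qed

lemma L2_inner_commute: "L2_inner Q f g = L2_inner Q g f"
  by (simp add: L2_inner_def mult.commute)

lemma lin_comb_mult:
  "lin_comb \<psi> a x * lin_comb \<phi> b x =
    (\<Sum>i<dim_vec a. \<Sum>j<dim_vec b. a $ i * b $ j * (\<psi> i x * \<phi> j x))"
  by (simp add: lin_comb_def sum_product algebra_simps)

lemma
  assumes "\<And>i. i < dim_vec a \<Longrightarrow> \<psi> i \<in> square_integrable Q"
    and "\<And>j. j < dim_vec b \<Longrightarrow> \<phi> j \<in> square_integrable Q"
  shows integrable_lin_comb_mult: "integrable Q (\<lambda>x. lin_comb \<psi> a x * lin_comb \<phi> b x)"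
    and L2_inner_lin_comb: "L2_inner Q (lin_comb \<psi> a) (lin_comb \<phi> b) =
      (\<Sum>i<dim_vec a. \<Sum>j<dim_vec b. a $ i * b $ j * L2_inner Q (\<psi> i) (\<phi> j))"
proof -
  have int: "integrable Q (\<lambda>x. a $ i * b $ j * (\<psi> i x * \<phi> j x))"
    if "i < dim_vec a" "j < dim_vec b" for i j
    using integrable_mult_square_integrable[OF assms(1)[OF that(1)] assms(2)[OF that(2)]]
    by (rule integrable_mult_right)
  show "integrable Q (\<lambda>x. lin_comb \<psi> a x * lin_comb \<phi> b x)"
    unfolding lin_comb_mult by (intro Bochner_Integration.integrable_sum) (simp only: int lessThan_iff)
  have "L2_inner Q (lin_comb \<psi> a) (lin_comb \<phi> b) =
      (\<Sum>i<dim_vec a. \<Sum>j<dim_vec b. LINT x|Q. a $ i * b $ j * (\<psi> i x * \<phi> j x))"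
    unfolding L2_inner_def lin_comb_mult
    by (intro Bochner_Integration.integral_sum[THEN trans] sum.cong refl
        Bochner_Integration.integrable_sum) (simp_all only: int lessThan_iff)
  then show "L2_inner Q (lin_comb \<psi> a) (lin_comb \<phi> b) =
      (\<Sum>i<dim_vec a. \<Sum>j<dim_vec b. a $ i * b $ j * L2_inner Q (\<psi> i) (\<phi> j))"
    by (simp only: L2_inner_def integral_mult_right_zero)
qed

lemma L2_inner_self_nonneg: "0 \<le> L2_inner Q f f"
  by (simp add: L2_inner_def)

lemma L2_norm_power2: "(L2_norm Q f)\<^sup>2 = L2_inner Q f f"
  by (simp add: L2_norm_def L2_inner_self_nonneg)

text \<open>A nonnegative integrable function with integral 0 vanishes almost everywhere, hence so
  does \<open>f\<close>. Integrability excludes an integral that is 0 only by default.\<close>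

lemma L2_inner_eq_0_if_self_eq_0:
  assumes "integrable Q (\<lambda>x. f x * f x)" "L2_inner Q f f = 0"
  shows "L2_inner Q f g = 0"
proof -
  have "AE x in Q. f x * f x = 0"
    using assms by (subst integral_nonneg_eq_0_iff_AE[symmetric]) (auto simp: L2_inner_def)
  then have "AE x in Q. f x * g x = 0" by auto
  then show ?thesis unfolding L2_inner_def by (rule integral_eq_zero_AE)
qed

subsection \<open>Vector norms and linear forms on the cube\<close>

lemma abs_le_linf_norm_vec: "i < dim_vec v \<Longrightarrow> \<bar>v $ i\<bar> \<le> linf_norm_vec v"
  by (simp add: linf_norm_vec_def)

lemma linf_norm_vec_leI:
  "0 \<le> c \<Longrightarrow> (\<And>i. i < dim_vec v \<Longrightarrow> \<bar>v $ i\<bar> \<le> c) \<Longrightarrow> linf_norm_vec v \<le> c"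
  by (simp add: linf_norm_vec_def)

text \<open>The first alternative covers dimension 0, which occurs for the image under
  \<open>gram21\<close> when \<open>S\<close> is the whole index range.\<close>

lemma linf_norm_vec_cases:
  obtains "linf_norm_vec v = 0" | i where "i < dim_vec v" "linf_norm_vec v = \<bar>v $ i\<bar>"
proof -
  have "linf_norm_vec v \<in> insert 0 ((\<lambda>i. \<bar>v $ i\<bar>) ` {..<dim_vec v})"
    unfolding linf_norm_vec_def by (rule Max_in) auto
  then show ?thesis using that by auto
qed

text \<open>Cauchy-Schwarz against the all-ones vector.\<close>

lemma sum_abs_le_sqrt_l2_norm_vec:
  "(\<Sum>k<dim_vec v. \<bar>v $ k\<bar>) \<le> sqrt (real (dim_vec v)) * l2_norm_vec v"
  unfolding l2_norm_vec_def real_sqrt_mult[symmetric]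
  using sum_squared_le_sum_of_squares[of "\<lambda>k. \<bar>v $ k\<bar>" "{..<dim_vec v}"]
  by (intro real_le_rsqrt) (simp add: mult.commute)

lemma mult_mat_vec_index:
  "i < dim_row M \<Longrightarrow> dim_vec v = dim_col M \<Longrightarrow> (M *\<^sub>v v) $ i = (\<Sum>k<dim_col M. M $$ (i, k) * v $ k)"
  by (simp add: scalar_prod_def atLeast0LessThan)

text \<open>Each coordinate of \<open>M \<tau>\<close> is maximised over the cube by the sign vector of a row of \<open>M\<close>.\<close>

lemma linf_norm_vec_mult_mat_vec_attains_max:
  fixes M :: "real mat"
  obtains \<tau> where "\<tau> \<in> carrier_vec (dim_col M)" "linf_norm_vec \<tau> \<le> 1"
    "\<And>\<tau>'. \<tau>' \<in> carrier_vec (dim_col M) \<Longrightarrow> linf_norm_vec \<tau>' \<le> 1 \<Longrightarrow>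
      linf_norm_vec (M *\<^sub>v \<tau>') \<le> linf_norm_vec (M *\<^sub>v \<tau>)"
proof -
  define n s where "n = dim_row M" and "s = dim_col M"
  define r where "r i = (\<Sum>k<s. \<bar>M $$ (i, k)\<bar>)" for i
  have r_bound: "\<bar>(M *\<^sub>v \<tau>) $ i\<bar> \<le> r i"
    if "i < n" "\<tau> \<in> carrier_vec s" "linf_norm_vec \<tau> \<le> 1" for i \<tau>
  proof -
    have "\<bar>(M *\<^sub>v \<tau>) $ i\<bar> \<le> (\<Sum>k<s. \<bar>M $$ (i, k) * \<tau> $ k\<bar>)"
      using that by (simp add: mult_mat_vec_index n_def s_def del: index_mult_mat_vec)
    also have "\<dots> \<le> r i"
      unfolding r_def
    proof (rule sum_mono)
      fix k assume "k \<in> {..<s}"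
      then have "\<bar>\<tau> $ k\<bar> \<le> 1"
        using abs_le_linf_norm_vec[of k \<tau>] that by auto
      then show "\<bar>M $$ (i, k) * \<tau> $ k\<bar> \<le> \<bar>M $$ (i, k)\<bar>"
        by (simp add: abs_mult mult_left_le)
    qed
    finally show ?thesis .
  qed
  show ?thesis
  proof (cases "n = 0")
    case True
    \<comment> \<open>Without rows every image has norm 0, so any point of the cube is a
      maximiser.\<close>
    show ?thesis
      by (rule that[of "0\<^sub>v s"])
        (use True in \<open>auto simp: s_def n_def linf_norm_vec_def\<close>)
  next
    case False
    have "Max (r ` {..<n}) \<in> r ` {..<n}"
      by (rule Max_in) (use False in auto)
    \<comment> \<open>Row \<open>i\<close> has the largest l1 norm, and its sign vector attains that
      norm as coordinate \<open>i\<close> of the image.\<close>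
    then obtain i where i: "i < n" "Max (r ` {..<n}) = r i" by auto
    have r_le: "r j \<le> r i" if "j < n" for j
      using that i(2)[symmetric] by simp
    define \<tau> where "\<tau> = vec s (\<lambda>k. sgn (M $$ (i, k)))"
    have dim: "\<tau> \<in> carrier_vec s" by (simp add: \<tau>_def)
    have le1: "linf_norm_vec \<tau> \<le> 1"
      by (rule linf_norm_vec_leI) (simp_all add: \<tau>_def abs_sgn_eq)
    have "(M *\<^sub>v \<tau>) $ i = r i"
      using i(1) by (simp add: mult_mat_vec_index n_def s_def \<tau>_def r_def abs_sgn[symmetric] del: index_mult_mat_vec)
    then have "r i \<le> linf_norm_vec (M *\<^sub>v \<tau>)"
      using abs_le_linf_norm_vec[of i "M *\<^sub>v \<tau>"] i(1) by (simp add: n_def)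
    moreover have "linf_norm_vec (M *\<^sub>v \<tau>') \<le> r i"
      if "\<tau>' \<in> carrier_vec s" "linf_norm_vec \<tau>' \<le> 1" for \<tau>'
    proof (rule linf_norm_vec_leI)
      show "0 \<le> r i" by (simp add: r_def sum_nonneg)
      fix j assume "j < dim_vec (M *\<^sub>v \<tau>')"
      then show "\<bar>(M *\<^sub>v \<tau>') $ j\<bar> \<le> r i"
        using r_bound[of j \<tau>'] r_le[of j] that by (simp add: n_def)
    qed
    ultimately show ?thesis
      using that[of \<tau>] dim le1 unfolding s_def by (meson order_trans)
  qed
qed

subsection \<open>Vectors indexed by positions in \<open>S\<close>\<close>

text \<open>Undoes the renumbering made by \<open>submatrix\<close>: the cardinality is the position
  of \<open>i\<close> in the increasing enumeration of \<open>S\<close>, and entries off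
  \<open>S\<close> are filled with 0.\<close>

definition scatter_vec :: "nat \<Rightarrow> nat set \<Rightarrow> real vec \<Rightarrow> real vec" where
  "scatter_vec p S v = vec p (\<lambda>i. if i \<in> S then v $ card {a \<in> S. a < i} else 0)"

lemma dim_scatter_vec [simp]: "dim_vec (scatter_vec p S v) = p"
  by (simp add: scatter_vec_def)

lemma bij_betw_pick:
  assumes "finite S"
  shows "bij_betw (pick S) {..<card S} S"
proof (rule bij_betw_byWitness[where f' = "\<lambda>i. card {a \<in> S. a < i}"])
  show "\<forall>k\<in>{..<card S}. card {a \<in> S. a < pick S k} = k"
    by (simp add: card_pick)
  show "\<forall>i\<in>S. pick S (card {a \<in> S. a < i}) = i"
    by (simp add: pick_card_in_set)
  show "pick S ` {..<card S} \<subseteq> S"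
    by (auto simp: pick_in_set_le)
  show "(\<lambda>i. card {a \<in> S. a < i}) ` S \<subseteq> {..<card S}"
    using assms by (auto intro!: psubset_card_mono)
qed

lemma scatter_vec_pick:
  assumes "S \<subseteq> {..<p}" "k < card S"
  shows "scatter_vec p S v $ pick S k = v $ k"
  using assms pick_in_set_le[of k S] card_pick_le[of k S]
  by (auto simp: scatter_vec_def)

text \<open>The condition on \<open>h\<close> removes the indices outside \<open>S\<close>; the rest
  is reindexing along \<open>pick\<close>. Norms, inner products and quadratic forms of scattered
  vectors all reduce to this.\<close>

lemma sum_scatter_vec:
  fixes h :: "nat \<Rightarrow> real \<Rightarrow> real"
  assumes "S \<subseteq> {..<p}" "\<And>i. h i 0 = 0"
  shows "(\<Sum>i<p. h i (scatter_vec p S v $ i)) = (\<Sum>k<card S. h (pick S k) (v $ k))"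
proof -
  have fin: "finite S" using assms(1) finite_subset by blast
  have "(\<Sum>i<p. h i (scatter_vec p S v $ i)) = (\<Sum>i\<in>S. h i (scatter_vec p S v $ i))"
    using assms by (intro sum.mono_neutral_right) (auto simp: scatter_vec_def)
  also have "\<dots> = (\<Sum>k<card S. h (pick S k) (scatter_vec p S v $ pick S k))"
    by (rule sum.reindex_bij_betw[OF bij_betw_pick[OF fin], symmetric])
  finally show ?thesis
    by (simp add: scatter_vec_pick[OF assms(1)])
qed

lemma scatter_vec_eq_0_iff:
  assumes "S \<subseteq> {..<p}" "v \<in> carrier_vec (card S)"
  shows "scatter_vec p S v = 0\<^sub>v p \<longleftrightarrow> v = 0\<^sub>v (card S)"
proof
  assume 0: "scatter_vec p S v = 0\<^sub>v p"
  show "v = 0\<^sub>v (card S)"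
  proof (rule eq_vecI)
    fix k assume "k < dim_vec (0\<^sub>v (card S) :: real vec)"
    moreover from this have "pick S k < p"
      using pick_in_set_le[of k S] assms(1) by auto
    ultimately show "v $ k = 0\<^sub>v (card S) $ k"
      using scatter_vec_pick[OF assms(1), of k v] 0 by simp
  qed (use assms(2) in simp)
next
  assume v: "v = 0\<^sub>v (card S)"
  have "finite S" using assms(1) finite_subset by blast
  then have "card {a \<in> S. a < i} < card S" if "i \<in> S" for i
    using that by (auto intro!: psubset_card_mono)
  with v show "scatter_vec p S v = 0\<^sub>v p"
    by (intro eq_vecI) (simp_all add: scatter_vec_def)
qed

lemma l2_norm_scatter_vec:
  assumes "S \<subseteq> {..<p}" "v \<in> carrier_vec (card S)"
  shows "l2_norm_vec (scatter_vec p S v) = l2_norm_vec v"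
  using sum_scatter_vec[OF assms(1), of "\<lambda>_ x. x\<^sup>2" v] assms(2) by (simp add: l2_norm_vec_def)

text \<open>Splits the test vector into its \<open>S\<close> part and a single spike outside
  \<open>S\<close>.\<close>

lemma restrict_scatter_add_unit:
  assumes "j < p" "j \<notin> S"
  shows "restrict_vec S (scatter_vec p S v + t \<cdot>\<^sub>v unit_vec p j) = scatter_vec p S v"
    and "restrict_vec (- S) (scatter_vec p S v + t \<cdot>\<^sub>v unit_vec p j) = t \<cdot>\<^sub>v unit_vec p j"
  using assms by (auto intro!: eq_vecI simp: restrict_vec_def scatter_vec_def unit_vec_def)

lemma l1_norm_smult_unit_vec:
  assumes "j < p"
  shows "l1_norm_vec (t \<cdot>\<^sub>v unit_vec p j) = \<bar>t\<bar>"
proof -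
  have "l1_norm_vec (t \<cdot>\<^sub>v unit_vec p j) = (\<Sum>i<p. if i = j then \<bar>t\<bar> else 0)"
    unfolding l1_norm_vec_def by (rule sum.cong) (auto simp: unit_vec_def)
  then show ?thesis using assms by simp
qed

lemma lin_comb_smult_unit_vec:
  assumes "j < p"
  shows "lin_comb \<psi> (t \<cdot>\<^sub>v unit_vec p j) = (\<lambda>x. t * \<psi> j x)"
proof
  fix x
  have "lin_comb \<psi> (t \<cdot>\<^sub>v unit_vec p j) x = (\<Sum>i<p. if i = j then t * \<psi> j x else 0)"
    unfolding lin_comb_def by (rule sum.cong) (auto simp: unit_vec_def)
  then show "lin_comb \<psi> (t \<cdot>\<^sub>v unit_vec p j) x = t * \<psi> j x" using assms by simp
qed

subsection \<open>The Gram blocks\<close>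

lemma Collect_less_Int: "S \<subseteq> {..<p} \<Longrightarrow> {i. i < (p::nat) \<and> i \<in> S} = S"
  by auto

lemma gram11_carrier: "S \<subseteq> {..<p} \<Longrightarrow> gram11 Q p \<psi> S \<in> carrier_mat (card S) (card S)"
  by (rule carrier_matI) (simp_all add: gram11_def gram_mat_def dim_submatrix Collect_less_Int)

lemma gram11_index:
  assumes "S \<subseteq> {..<p}" "k < card S" "l < card S"
  shows "gram11 Q p \<psi> S $$ (k, l) = L2_inner Q (\<psi> (pick S k)) (\<psi> (pick S l))"
proof -
  have "pick S k < p" "pick S l < p"
    using assms pick_in_set_le[of k S] pick_in_set_le[of l S] by auto
  then show ?thesis
    using assms by (simp add: gram11_def submatrix_index gram_mat_def Collect_less_Int)
qed

lemma gram21_dim: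
  "dim_row (gram21 Q p \<psi> S) = card {i. i < p \<and> i \<notin> S}"
  "S \<subseteq> {..<p} \<Longrightarrow> dim_col (gram21 Q p \<psi> S) = card S"
  by (simp_all add: gram21_def gram_mat_def dim_submatrix Collect_less_Int)

text \<open>Rows of \<open>gram21\<close> are numbered by \<open>pick\<close> on the complement in
  all naturals; its first values are exactly those below \<open>p\<close>, so row numbers never
  leave the range.\<close>

lemma pick_Compl:
  assumes "i < card {i. i < p \<and> i \<notin> S}"
  shows "pick (- S) i < p" "pick (- S) i \<notin> S"
proof -
  show "pick (- S) i < p"
    using assms by (intro pick_le) simp
  have "{i. i < p \<and> i \<notin> S} \<subseteq> - S" by auto
  \<comment> \<open>\<open>pick\<close> stays in an infinite set for every index, in a finite one
    only below its cardinality; \<open>S\<close> is arbitrary here, so both cases arise.\<close>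
  then have "finite (- S) \<Longrightarrow> i < card (- S)"
    using assms card_mono by (meson order_less_le_trans)
  then have "pick (- S) i \<in> - S"
    using pick_in_set_inf pick_in_set_le by blast
  then show "pick (- S) i \<notin> S" by simp
qed

lemma gram21_index:
  assumes "S \<subseteq> {..<p}" "i < card {i. i < p \<and> i \<notin> S}" "k < card S"
  shows "gram21 Q p \<psi> S $$ (i, k) = L2_inner Q (\<psi> (pick (- S) i)) (\<psi> (pick S k))"
proof -
  have "pick S k < p"
    using assms pick_Compl[OF assms(2)] pick_in_set_le[of k S] by auto
  then show ?thesis
    using assms pick_Compl[OF assms(2)]
    by (simp add: gram21_def submatrix_index gram_mat_def Collect_less_Int)
qed

text \<open>Bridges two notions of inverse: \<open>invertible_mat\<close> supplies a two-sided
  inverse of unstated dimensions, whereas \<open>mat_inverse\<close> is specified through the units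
  of the matrix ring.\<close>

lemma mat_inverse_invertible:
  fixes A :: "'b::field mat"
  assumes "A \<in> carrier_mat n n" "invertible_mat A"
  shows "the (mat_inverse A) \<in> carrier_mat n n" "A * the (mat_inverse A) = 1\<^sub>m n"
proof -
  obtain B where B: "A * B = 1\<^sub>m n" "B * A = 1\<^sub>m (dim_row B)"
    using assms by (auto simp: invertible_mat_def inverts_mat_def)
  \<comment> \<open>Comparing column counts in the two products yields both dimensions of
    \<open>B\<close>.\<close>
  have "B \<in> carrier_mat n n"
    using arg_cong[OF B(1), of dim_col] arg_cong[OF B(2), of dim_col] assms(1) by auto
  with B assms(1) have "A \<in> Units (ring_mat TYPE('b) n ())"
    by (auto simp: Units_def ring_mat_def)
  then obtain C where C: "mat_inverse A = Some C"
    using mat_inverse(1)[OF assms(1), of "()"] by (cases "mat_inverse A") auto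
  show "the (mat_inverse A) \<in> carrier_mat n n" "A * the (mat_inverse A) = 1\<^sub>m n"
    using mat_inverse(2)[OF assms(1) C] C by auto
qed

subsection \<open>Comparison of the two constants\<close>

lemma theta_adaptive_upper:
  assumes "\<beta> \<in> carrier_vec p" "restrict_vec S \<beta> \<noteq> 0\<^sub>v p"
    "l1_norm_vec (restrict_vec (- S) \<beta>)
      \<le> sqrt (real (card S)) * l2_norm_vec (restrict_vec S \<beta>)"
  shows "ereal (\<bar>L2_inner Q (lin_comb \<psi> (restrict_vec S \<beta>)) (lin_comb \<psi> (restrict_vec (- S) \<beta>))\<bar>
                   / (L2_norm Q (lin_comb \<psi> (restrict_vec S \<beta>)))\<^sup>2) \<le> theta_adaptive Q p \<psi> S"
  unfolding theta_adaptive_def using assms by (intro Sup_upper) blast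

text \<open>All ratios are nonnegative, so one admissible vector suffices; without any, the supremum
  would be minus infinity. A unit vector at an index of \<open>S\<close> is admissible.\<close>

lemma theta_adaptive_nonneg:
  assumes "S \<subseteq> {..<p}" "S \<noteq> {}"
  shows "0 \<le> theta_adaptive Q p \<psi> S"
proof -
  obtain j where j: "j \<in> S" "j < p" using assms by auto
  define \<beta> :: "real vec" where "\<beta> = unit_vec p j"
  have r: "restrict_vec S \<beta> = \<beta>" "restrict_vec (- S) \<beta> = 0\<^sub>v p"
    using j by (auto intro!: eq_vecI simp: restrict_vec_def \<beta>_def unit_vec_def)
  have "\<beta> \<noteq> 0\<^sub>v p"
    using j by (auto simp: \<beta>_def dest: arg_cong[where f = "\<lambda>v. v $ j"])
  moreover have "l1_norm_vec (0\<^sub>v p) \<le> sqrt (real (card S)) * l2_norm_vec \<beta>"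
    by (simp add: l1_norm_vec_def l2_norm_vec_def sum_nonneg)
  ultimately have "ereal (\<bar>L2_inner Q (lin_comb \<psi> \<beta>) (lin_comb \<psi> (0\<^sub>v p))\<bar>
      / (L2_norm Q (lin_comb \<psi> \<beta>))\<^sup>2) \<le> theta_adaptive Q p \<psi> S"
    using theta_adaptive_upper[of \<beta> p S Q \<psi>] by (simp add: r) (simp add: \<beta>_def)
  then show ?thesis
    by (rule order_trans[rotated]) simp
qed

text \<open>Applied with \<open>D\<close> the squared norm of \<open>f\<close> and \<open>c\<close>
  the maximal entry. Since division by 0 gives 0, the case \<open>D = 0\<close> rests on the last
  assumption.\<close>

lemma abs_le_scaled_ratio:
  fixes c t D :: real
  assumes "0 \<le> D" "D \<le> t" "D = 0 \<Longrightarrow> c = 0"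
  shows "\<bar>c\<bar> \<le> \<bar>t * c\<bar> / D"
proof (cases "D = 0")
  case False
  with assms show ?thesis
    by (simp add: field_simps abs_mult mult_right_mono)
qed (use assms in simp)

text \<open>The core estimate in terms of \<open>v\<close> instead of \<tau>: the image of
  \<open>v\<close> under \<open>gram11\<close> takes the place of \<tau>, so no inverse
  appears.\<close>

lemma linf_norm_gram_le_theta_adaptive:
  fixes \<psi> :: "nat \<Rightarrow> 'a \<Rightarrow> real"
  assumes sq: "\<And>j. j < p \<Longrightarrow> \<psi> j \<in> square_integrable Q"
    and S: "S \<subseteq> {..<p}" "S \<noteq> {}"
    and v: "v \<in> carrier_vec (card S)"
    and le1: "linf_norm_vec (gram11 Q p \<psi> S *\<^sub>v v) \<le> 1"
  shows "ereal (linf_norm_vec (gram21 Q p \<psi> S *\<^sub>v v)) \<le> theta_adaptive Q p \<psi> S"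
proof (cases "gram21 Q p \<psi> S *\<^sub>v v" rule: linf_norm_vec_cases)
  case 1
  then show ?thesis using theta_adaptive_nonneg[OF S] by (simp add: zero_ereal_def)
next
  case (2 i)
  define s where "s = card S"
  have i: "i < card {i. i < p \<and> i \<notin> S}" using 2(1) by (simp add: gram21_dim)
  define j where "j = pick (- S) i"
  have j: "j < p" "j \<notin> S" using pick_Compl[OF i] by (simp_all add: j_def)
  define f where "f = lin_comb \<psi> (scatter_vec p S v)"
  define t where "t = sqrt (real s) * l2_norm_vec v"
  \<comment> \<open>The scalar serves two uses: \<open>c = 1\<close> gives the matrix entry,
    \<open>c = t\<close> the numerator of the ratio.\<close>
  have f_inner: "L2_inner Q f (\<lambda>x. c * \<psi> l x)
      = c * (\<Sum>k<s. v $ k * L2_inner Q (\<psi> (pick S k)) (\<psi> l))" if "l < p" for c l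
  proof -
    have "L2_inner Q f (\<lambda>x. c * \<psi> l x) = L2_inner Q f (lin_comb \<psi> (c \<cdot>\<^sub>v unit_vec p l))"
      using that by (simp add: lin_comb_smult_unit_vec)
    also have "\<dots> = (\<Sum>a<p. \<Sum>b<p. scatter_vec p S v $ a * (c \<cdot>\<^sub>v unit_vec p l) $ b * L2_inner Q (\<psi> a) (\<psi> b))"
      unfolding f_def using sq by (subst L2_inner_lin_comb) auto
    also have "\<dots> = (\<Sum>a<p. c * (scatter_vec p S v $ a * L2_inner Q (\<psi> a) (\<psi> l)))"
    proof (rule sum.cong[OF refl])
      fix a
      have "(\<Sum>b<p. scatter_vec p S v $ a * (c \<cdot>\<^sub>v unit_vec p l) $ b * L2_inner Q (\<psi> a) (\<psi> b))
        = (\<Sum>b<p. if b = l then c * (scatter_vec p S v $ a * L2_inner Q (\<psi> a) (\<psi> l)) else 0)"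
        by (rule sum.cong) (auto simp: unit_vec_def)
      then show "(\<Sum>b<p. scatter_vec p S v $ a * (c \<cdot>\<^sub>v unit_vec p l) $ b * L2_inner Q (\<psi> a) (\<psi> b))
        = c * (scatter_vec p S v $ a * L2_inner Q (\<psi> a) (\<psi> l))"
        using that by simp
    qed
    also have "\<dots> = c * (\<Sum>k<s. v $ k * L2_inner Q (\<psi> (pick S k)) (\<psi> l))"
      using sum_scatter_vec[OF S(1), of "\<lambda>a x. x * L2_inner Q (\<psi> a) (\<psi> l)" v]
      by (simp add: sum_distrib_left[symmetric] s_def)
    finally show ?thesis .
  qed
  have c: "(gram21 Q p \<psi> S *\<^sub>v v) $ i = L2_inner Q f (\<psi> j)"
    using f_inner[OF j(1), of 1] i v
    by (simp add: mult_mat_vec_index gram21_dim S gram21_index s_def j_def[symmetric] mult.commute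
        L2_inner_commute[of Q "\<psi> j"] del: index_mult_mat_vec)
  have D: "L2_inner Q f f = (\<Sum>k<s. v $ k * (gram11 Q p \<psi> S *\<^sub>v v) $ k)"
  proof -
    have "L2_inner Q f f = (\<Sum>a<p. scatter_vec p S v $ a *
        (\<Sum>b<p. scatter_vec p S v $ b * L2_inner Q (\<psi> a) (\<psi> b)))"
      unfolding f_def using sq by (subst L2_inner_lin_comb) (auto simp: sum_distrib_left mult.assoc)
    also have "\<dots> = (\<Sum>a<p. scatter_vec p S v $ a *
        (\<Sum>l<s. v $ l * L2_inner Q (\<psi> a) (\<psi> (pick S l))))"
      using sum_scatter_vec[OF S(1), of "\<lambda>b x. x * L2_inner Q (\<psi> _) (\<psi> b)" v] by (simp add: s_def)
    also have "\<dots> = (\<Sum>k<s. v $ k * (\<Sum>l<s. v $ l * L2_inner Q (\<psi> (pick S k)) (\<psi> (pick S l))))"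
      using sum_scatter_vec[OF S(1), of "\<lambda>a x. x * (\<Sum>l<s. v $ l * L2_inner Q (\<psi> a) (\<psi> (pick S l)))" v]
      by (simp add: s_def)
    also have "\<dots> = (\<Sum>k<s. v $ k * (gram11 Q p \<psi> S *\<^sub>v v) $ k)"
    proof (rule sum.cong[OF refl])
      fix k assume "k \<in> {..<s}"
      then show "v $ k * (\<Sum>l<s. v $ l * L2_inner Q (\<psi> (pick S k)) (\<psi> (pick S l)))
          = v $ k * (gram11 Q p \<psi> S *\<^sub>v v) $ k"
        using gram11_carrier[OF S(1), of Q \<psi>] v
        by (auto simp: mult_mat_vec_index gram11_index[OF S(1)] s_def mult.commute intro!: sum.cong simp del: index_mult_mat_vec)
    qed
    finally show ?thesis .
  qed
  \<comment> \<open>Duality of the l1 and sup norms, as \<open>gram11\<close> maps \<open>v\<close>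
    into the unit cube.\<close>
  have "L2_inner Q f f \<le> (\<Sum>k<s. \<bar>v $ k\<bar>)"
    unfolding D
  proof (rule sum_mono)
    fix k assume "k \<in> {..<s}"
    then have "\<bar>(gram11 Q p \<psi> S *\<^sub>v v) $ k\<bar> \<le> 1"
      using abs_le_linf_norm_vec[of k "gram11 Q p \<psi> S *\<^sub>v v"] le1 gram11_carrier[OF S(1), of Q \<psi>]
      by (simp add: s_def)
    then have "\<bar>v $ k * (gram11 Q p \<psi> S *\<^sub>v v) $ k\<bar> \<le> \<bar>v $ k\<bar>"
      unfolding abs_mult by (intro mult_left_le) auto
    then show "v $ k * (gram11 Q p \<psi> S *\<^sub>v v) $ k \<le> \<bar>v $ k\<bar>" by linarith
  qed
  also have "\<dots> \<le> t"
    using sum_abs_le_sqrt_l2_norm_vec[of v] v by (simp add: t_def s_def)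
  finally have D_le: "L2_inner Q f f \<le> t" .
  have "L2_inner Q f f = 0 \<Longrightarrow> L2_inner Q f (\<psi> j) = 0"
    unfolding f_def by (rule L2_inner_eq_0_if_self_eq_0) (use sq in \<open>auto intro: integrable_lin_comb_mult\<close>)
  then have bound: "\<bar>L2_inner Q f (\<psi> j)\<bar> \<le> \<bar>t * L2_inner Q f (\<psi> j)\<bar> / L2_inner Q f f"
    by (rule abs_le_scaled_ratio[OF L2_inner_self_nonneg D_le])
  show ?thesis
  \<comment> \<open>For \<open>v = 0\<close> the test vector is inadmissible because its
    \<open>S\<close> part vanishes, but then the entry itself is 0.\<close>
  proof (cases "v = 0\<^sub>v s")
    case True
    then have "L2_inner Q f (\<psi> j) = 0" using f_inner[OF j(1), of 1] by simp
    then show ?thesis using 2(2) c theta_adaptive_nonneg[OF S] by (simp add: zero_ereal_def)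
  next
    case False
    define \<beta> where "\<beta> = scatter_vec p S v + t \<cdot>\<^sub>v unit_vec p j"
    note r = restrict_scatter_add_unit[OF j, of v t, folded \<beta>_def]
    have "0 \<le> t" by (simp add: t_def l2_norm_vec_def sum_nonneg)
    \<comment> \<open>By the choice of \<open>t\<close> the constraint holds with equality.\<close>
    then have "l1_norm_vec (restrict_vec (- S) \<beta>)
        \<le> sqrt (real (card S)) * l2_norm_vec (restrict_vec S \<beta>)"
      unfolding r l1_norm_smult_unit_vec[OF j(1)] l2_norm_scatter_vec[OF S(1) v]
      by (simp add: t_def s_def)
    moreover have "\<beta> \<in> carrier_vec p"
      by (simp add: \<beta>_def carrier_dim_vec)
    moreover have "restrict_vec S \<beta> \<noteq> 0\<^sub>v p"
      using False unfolding r scatter_vec_eq_0_iff[OF S(1) v] s_def .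
    ultimately have "ereal (\<bar>L2_inner Q f (\<lambda>x. t * \<psi> j x)\<bar> / (L2_norm Q f)\<^sup>2) \<le> theta_adaptive Q p \<psi> S"
      using theta_adaptive_upper[of \<beta> p S Q \<psi>]
      unfolding r f_def lin_comb_smult_unit_vec[OF j(1)] by blast
    moreover have "L2_inner Q f (\<lambda>x. t * \<psi> j x) = t * L2_inner Q f (\<psi> j)"
      using f_inner[OF j(1), of t] f_inner[OF j(1), of 1] by simp
    ultimately have "ereal (\<bar>t * L2_inner Q f (\<psi> j)\<bar> / L2_inner Q f f) \<le> theta_adaptive Q p \<psi> S"
      by (simp add: L2_norm_power2)
    then show ?thesis
      using bound unfolding 2(2) c by (meson ereal_less_eq(3) order_trans)
  qed
qed

theorem theorem5p1:
  fixes Q :: "'a measure"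
    and p :: nat
    and \<psi> :: "nat \<Rightarrow> 'a \<Rightarrow> real"
    and S :: "nat set"
  assumes "prob_space Q"
    and "\<And>j. j < p \<Longrightarrow> \<psi> j \<in> square_integrable Q"
    and "S \<subseteq> {..<p}"
    and "S \<noteq> {}"
    and "invertible_mat (gram11 Q p \<psi> S)"
  shows "ereal (theta_irrepresentable Q p \<psi> S) \<le> theta_adaptive Q p \<psi> S"
proof -
  let ?A = "gram11 Q p \<psi> S" and ?C = "gram21 Q p \<psi> S"
  define s where "s = card S"
  define B where "B = the (mat_inverse ?A)"
  note A = gram11_carrier[OF assms(3), of Q \<psi>, folded s_def]
  have B: "B \<in> carrier_mat s s" "?A * B = 1\<^sub>m s"
    unfolding B_def using mat_inverse_invertible[OF A assms(5)] by auto
  have C: "?C \<in> carrier_mat (dim_row ?C) s"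
    unfolding s_def by (intro carrier_matI refl gram21_dim(2) assms(3))
  \<comment> \<open>Merging the two matrices lets the attainment lemma for a single matrix provide
    the maximiser, which gives \<open>GREATEST\<close> its value.\<close>
  have assoc: "?C *\<^sub>v (B *\<^sub>v \<tau>) = (?C * B) *\<^sub>v \<tau>" if "\<tau> \<in> carrier_vec s" for \<tau>
    using C B(1) that by (simp add: assoc_mult_mat_vec)
  obtain \<tau> where \<tau>: "\<tau> \<in> carrier_vec s" "linf_norm_vec \<tau> \<le> 1"
    and max: "\<And>\<tau>'. \<tau>' \<in> carrier_vec s \<Longrightarrow> linf_norm_vec \<tau>' \<le> 1 \<Longrightarrow>
      linf_norm_vec ((?C * B) *\<^sub>v \<tau>') \<le> linf_norm_vec ((?C * B) *\<^sub>v \<tau>)"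
    using linf_norm_vec_mult_mat_vec_attains_max[of "?C * B"] B(1) by auto
  have "theta_irrepresentable Q p \<psi> S = linf_norm_vec (?C *\<^sub>v (B *\<^sub>v \<tau>))"
    unfolding theta_irrepresentable_def B_def[symmetric] s_def[symmetric]
  proof (rule Greatest_equality)
    show "linf_norm_vec (?C *\<^sub>v (B *\<^sub>v \<tau>)) \<in>
        {linf_norm_vec (?C *\<^sub>v (B *\<^sub>v \<tau>)) | \<tau>. \<tau> \<in> carrier_vec s \<and> linf_norm_vec \<tau> \<le> 1}"
      using \<tau> by blast
  next
    fix m
    assume "m \<in> {linf_norm_vec (?C *\<^sub>v (B *\<^sub>v \<tau>)) | \<tau>. \<tau> \<in> carrier_vec s \<and> linf_norm_vec \<tau> \<le> 1}"
    then obtain \<tau>' where "m = linf_norm_vec (?C *\<^sub>v (B *\<^sub>v \<tau>'))"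
      "\<tau>' \<in> carrier_vec s" "linf_norm_vec \<tau>' \<le> 1" by blast
    then show "m \<le> linf_norm_vec (?C *\<^sub>v (B *\<^sub>v \<tau>))"
      using max[of \<tau>'] by (simp only: assoc \<tau>(1))
  qed
  \<comment> \<open>With \<open>v\<close> taken as \<open>B *\<^sub>v \<tau>\<close>, the cube
    condition on \<tau> becomes the hypothesis of the core estimate.\<close>
  moreover have "?A *\<^sub>v (B *\<^sub>v \<tau>) = \<tau>"
    using assoc_mult_mat_vec[OF A B(1) \<tau>(1)] B(2) \<tau>(1) by simp
  moreover have "B *\<^sub>v \<tau> \<in> carrier_vec (card S)"
    using B(1) \<tau>(1) by (simp add: s_def)
  ultimately show ?thesis
    using linf_norm_gram_le_theta_adaptive[OF assms(2-4), where v = "B *\<^sub>v \<tau>"] \<tau>(2) by simp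
qed

end
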